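(* Let $\mathcal{S}=\langle S,(A^i,r^i)_{i=1}^N,p\rangle$ be a finite $N$-agent stochastic game with discount factors $\gamma^i\in(0,1]$, $i=1,\dots,N$, let $M\ge 1$ be an integer, and let $\widehat{\mathcal S}=\langle M,S,(A^i,r^i)_{i=1}^N,p\rangle$ be its finite-horizon version with horizon length $M$. Let $\overline{\pi}=(\overline{\pi}^i)_{i=1}^N$ be an $M$-episodic strategy profile for which there exist $\widehat{\epsilon}^i\ge 0$, $i=1,\dots,N$, such that $$\widehat{U}^i(\overline{\pi}^i,\overline{\pi}^{-i};s)\ \ge\ \widehat{U}^i(\widehat{\pi}^i,\overline{\pi}^{-i};s)-\widehat{\epsilon}^i\qquad\text{for all }\widehat{\pi}^i\in\widehat{\Pi}^i,\ i=1,\dots,N,\text{ and } s\in S .$$ Then, for every initial state $s\in S$, $\overline{\pi}$ is an $\epsilon$-episodic equilibrium for $\mathcal{S}$ with $\epsilon=(\epsilon^i)_{i=1}^N$, i.e., $$U^i(\overline{\pi}^i,\overline{\pi}^{-i};s)\ \ge\ U^i(\pi^i,\overline{\pi}^{-i};s)-\epsilon^i\qquad\text{for all }\pi^i\in\Pi^i\text{ and } i=1,\dots,N,$$ where $$\epsilon^i=\begin{cases}(\delta^i+\widehat{\epsilon}^i)\cdot\dfrac{1}{M} & \text{if }\gamma^i=1,\\[2ex] \big((\gamma^i)^M\cdot\delta^i+\widehat{\epsilon}^i\big)\cdot\dfrac{1-\gamma^i}{1-(\gamma^i)^M} & \text{if }\gamma^i\in(0,1),\end{cases}$$ and $$\delta^i:=\max_{s\in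 S}\widehat{U}^i(\overline{\pi}^i,\overline{\pi}^{-i};s)-\min_{s\in S}\widehat{U}^i(\overline{\pi}^i,\overline{\pi}^{-i};s).$$
   Context: **Stochastic game.** An $N$-agent stochastic game (SG) is a tuple $\mathcal{S}=\langle S,(A^i,r^i)_{i=1}^N,p\rangle$, where $S$ is a finite set of states, $A^i$ is the finite action set of agent $i$, $A:=\prod_{i=1}^N A^i$, $r^i:S\times A\to\mathbb{R}$ is the reward function of agent $i$, and $p(s_+\mid s,a)$ is the probability of transition from $s\in S$ to $s_+\in S$ under the joint action $a\in A$. At each stage $k=0,1,\dots$ all agents observe the state $s_k$, recall the history $h_k=\{s_k,s_{k-1},a_{k-1},\dots,s_0,a_0\}$, and simultaneously choose actions, randomizing independently of each other. A behavioral strategy $\pi^i$ of agent $i$ assigns to every history $h_k$ a probability distribution on $A^i$; $\Pi^i$ is the set of all behavioral strategies of agent $i$. A superscript $-i$ denotes all agents other than $i$. **Infinite-horizon utility.** Each agent $i$ has a discount factor $\gamma^i\in(0,1]$, possibly different across agents. For a strategy profile $\pi=(\pi^j)_{j=1}^N$ and initial state $s$, $$U^i(\pi;s):=\lim_{K\to\infty}\frac{1}{\sum_{k=0}^K(\gamma^i)^k}\,\mathrm{E}\Big[\sum_{k=0}^K(\gamma^i)^k r^i(s_k,a_k)\ \Big|\ s_0=s\Big],$$ the expectation being over the randomness induced by $p$ and $\pi$. Thus $\gamma^i=1$ is the time-averaged case and $\gamma^i\in(0,1)$ the (normalized) discounted case. When $\gamma^i=1$, inequalities involving $U^i(\pi;s)$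 are understood for strategy profiles for which this limit exists. **Finite-horizon version.** In $\widehat{\mathcal S}=\langle M,S,(A^i,r^i)_{i=1}^N,p\rangle$ the same game is played only for stages $k=0,\dots,M-1$. $\widehat{\Pi}^i$ denotes the set of agent $i$'s behavioral (history-dependent) strategies in this finite-horizon game, and the utility is $$\widehat{U}^i(\widehat{\pi};s):=\mathrm{E}\Big[\sum_{k=0}^{M-1}(\gamma^i)^k r^i(s_k,a_k)\ \Big|\ s_0=s\Big].$$ **Episodic strategies.** Let $\overline{M}:=\{0,1,\dots,M-1\}$, $\overline{S}:=S\times\overline{M}$, and let $\Delta^i$ be the probability simplex over $A^i$. An ($M$-)episodic strategy of agent $i$ is a map $\overline{\pi}^i:\overline{S}\to\Delta^i$. In $\mathcal{S}$ it is played by using, at stage $k$, the mixed action $\overline{\pi}^i(s_k,\,k \bmod M)$; in $\widehat{\mathcal S}$ it is the Markov strategy that uses $\overline{\pi}^i(s_k,k)$ at stage $k\in\overline{M}$. **Equilibrium.** A strategy profile $\pi_*$ is an $\epsilon$-Nash equilibrium of $\mathcal{S}$ with initial state $s$, where $\epsilon=(\epsilon^i)_{i=1}^N$, if $U^i(\pi_*^i,\pi_*^{-i};s)\ge U^i(\pi^i,\pi_*^{-i};s)-\epsilon^i$ for all $\pi^i\in\Pi^i$ and all $i$. It is an $\epsilon$-episodic equilibrium if, in addition, every component is an episodic strategy. *)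

theory Defs
  imports "HOL-Probability.Probability"
begin

text \<open>
  States and agents range over finite types, so the number of agents is the cardinality of
  \<open>'i\<close>.  The action sets may differ between agents; they are subsets of a common type \<open>'a\<close>.
\<close>

record ('s, 'i, 'a) game =
  act :: "'i \<Rightarrow> 'a set"
  rew :: "'i \<Rightarrow> 's \<Rightarrow> ('i \<Rightarrow> 'a) \<Rightarrow> real"
  trans :: "'s \<Rightarrow> ('i \<Rightarrow> 'a) \<Rightarrow> 's pmf"

definition stochastic_game :: "('s::finite, 'i::finite, 'a) game \<Rightarrow> bool" where
  "stochastic_game G \<longleftrightarrow> (\<forall>i. finite (act G i) \<and> act G i \<noteq> {})"

definition joint_actions :: "('s, 'i, 'a) game \<Rightarrow> ('i \<Rightarrow> 'a) set" where
  "joint_actions G = {a. \<forall>i. a i \<in> act G i}"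

text \<open>
  The pair \<open>([(s\<^sub>0, a\<^sub>0), \<dots>, (s\<^bsub>k-1\<^esub>, a\<^bsub>k-1\<^esub>)], s\<^sub>k)\<close> is the history at stage \<open>k\<close>; the stage is the
  length of the list.
\<close>

type_synonym ('s, 'i, 'a) history = "('s \<times> ('i \<Rightarrow> 'a)) list \<times> 's"
type_synonym ('s, 'i, 'a) strategy = "('s, 'i, 'a) history \<Rightarrow> 'a pmf"

definition stage :: "('s, 'i, 'a) history \<Rightarrow> nat" where
  "stage h = length (fst h)"

definition histories :: "('s, 'i, 'a) game \<Rightarrow> ('s, 'i, 'a) history set" where
  "histories G = {h. \<forall>(x, a) \<in> set (fst h). a \<in> joint_actions G}"

definition strategies :: "('s, 'i, 'a) game \<Rightarrow> 'i \<Rightarrow> ('s, 'i, 'a) strategy set" where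
  "strategies G i = {\<sigma>. \<forall>h \<in> histories G. set_pmf (\<sigma> h) \<subseteq> act G i}"

definition fin_strategies ::
    "('s, 'i, 'a) game \<Rightarrow> nat \<Rightarrow> 'i \<Rightarrow> ('s, 'i, 'a) strategy set" where
  "fin_strategies G M i =
     {\<sigma>. \<forall>h \<in> histories G. stage h < M \<longrightarrow> set_pmf (\<sigma> h) \<subseteq> act G i}"

text \<open>
  Law of the stage-\<open>k\<close> history from initial state \<open>s\<close>.  The default value of \<^const>\<open>Pi_pmf\<close> is
  never used, since the index set is the whole finite type.
\<close>

primrec history_law ::
    "('s, 'i::finite, 'a) game \<Rightarrow> ('i \<Rightarrow> ('s, 'i, 'a) strategy) \<Rightarrow> 's \<Rightarrow> nat \<Rightarrow>
     ('s, 'i, 'a) history pmf" where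
  "history_law G \<pi> s 0 = return_pmf ([], s)"
| "history_law G \<pi> s (Suc k) =
     bind_pmf (history_law G \<pi> s k) (\<lambda>h.
     bind_pmf (Pi_pmf UNIV undefined (\<lambda>i. \<pi> i h)) (\<lambda>a.
     bind_pmf (trans G (snd h) a) (\<lambda>y.
     return_pmf (fst h @ [(snd h, a)], y))))"

definition expected_return ::
    "('s, 'i::finite, 'a) game \<Rightarrow> ('i \<Rightarrow> real) \<Rightarrow> nat \<Rightarrow> ('i \<Rightarrow> ('s, 'i, 'a) strategy) \<Rightarrow>
     'i \<Rightarrow> 's \<Rightarrow> real" where
  "expected_return G \<gamma> n \<pi> i s =
     measure_pmf.expectation (history_law G \<pi> s n)
       (\<lambda>h. \<Sum>k<n. \<gamma> i ^ k * rew G i (fst (fst h ! k)) (snd (fst h ! k)))"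

definition normalized_return ::
    "('s, 'i::finite, 'a) game \<Rightarrow> ('i \<Rightarrow> real) \<Rightarrow> ('i \<Rightarrow> ('s, 'i, 'a) strategy) \<Rightarrow>
     'i \<Rightarrow> 's \<Rightarrow> nat \<Rightarrow> real" where
  "normalized_return G \<gamma> \<pi> i s K =
     1 / (\<Sum>k\<le>K. \<gamma> i ^ k) * expected_return G \<gamma> (Suc K) \<pi> i s"

definition utility ::
    "('s, 'i::finite, 'a) game \<Rightarrow> ('i \<Rightarrow> real) \<Rightarrow> ('i \<Rightarrow> ('s, 'i, 'a) strategy) \<Rightarrow>
     'i \<Rightarrow> 's \<Rightarrow> real" where
  "utility G \<gamma> \<pi> i s = lim (normalized_return G \<gamma> \<pi> i s)"

definition utility_exists ::
    "('s, 'i::finite, 'a) game \<Rightarrow> ('i \<Rightarrow> real) \<Rightarrow> ('i \<Rightarrow> ('s, 'i, 'a) strategy) \<Rightarrow>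
     'i \<Rightarrow> 's \<Rightarrow> bool" where
  "utility_exists G \<gamma> \<pi> i s \<longleftrightarrow> convergent (normalized_return G \<gamma> \<pi> i s)"

definition fin_utility ::
    "('s, 'i::finite, 'a) game \<Rightarrow> ('i \<Rightarrow> real) \<Rightarrow> nat \<Rightarrow> ('i \<Rightarrow> ('s, 'i, 'a) strategy) \<Rightarrow>
     'i \<Rightarrow> 's \<Rightarrow> real" where
  "fin_utility G \<gamma> M \<pi> i s = expected_return G \<gamma> M \<pi> i s"

definition episodic_strategies ::
    "('s, 'i, 'a) game \<Rightarrow> nat \<Rightarrow> 'i \<Rightarrow> ('s \<Rightarrow> nat \<Rightarrow> 'a pmf) set" where
  "episodic_strategies G M i = {\<sigma>. \<forall>x. \<forall>m<M. set_pmf (\<sigma> x m) \<subseteq> act G i}"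

definition play_episodic :: "nat \<Rightarrow> ('s \<Rightarrow> nat \<Rightarrow> 'a pmf) \<Rightarrow> ('s, 'i, 'a) strategy" where
  "play_episodic M \<sigma> h = \<sigma> (snd h) (stage h mod M)"

definition play_markov :: "('s \<Rightarrow> nat \<Rightarrow> 'a pmf) \<Rightarrow> ('s, 'i, 'a) strategy" where
  "play_markov \<sigma> h = \<sigma> (snd h) (stage h)"

text \<open>
  For \<open>\<gamma> i = 1\<close> the limit defining the utility may fail to exist.  The utility of the equilibrium
  profile is required to exist, and it is compared with those deviations whose utility exists.
  For \<open>0 < \<gamma> i < 1\<close> the limit always exists, so both conditions hold automatically.
\<close>

definition eps_nash_equilibrium ::
    "('s, 'i::finite, 'a) game \<Rightarrow> ('i \<Rightarrow> real) \<Rightarrow> 's \<Rightarrow> ('i \<Rightarrow> real) \<Rightarrow>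
     ('i \<Rightarrow> ('s, 'i, 'a) strategy) \<Rightarrow> bool" where
  "eps_nash_equilibrium G \<gamma> s \<epsilon> \<pi> \<longleftrightarrow>
     (\<forall>i. \<pi> i \<in> strategies G i) \<and>
     (\<forall>i. utility_exists G \<gamma> \<pi> i s \<and>
       (\<forall>\<sigma> \<in> strategies G i. utility_exists G \<gamma> (\<pi>(i := \<sigma>)) i s \<longrightarrow>
          utility G \<gamma> \<pi> i s \<ge> utility G \<gamma> (\<pi>(i := \<sigma>)) i s - \<epsilon> i))"

definition eps_episodic_equilibrium ::
    "('s, 'i::finite, 'a) game \<Rightarrow> ('i \<Rightarrow> real) \<Rightarrow> nat \<Rightarrow> 's \<Rightarrow> ('i \<Rightarrow> real) \<Rightarrow>
     ('i \<Rightarrow> ('s, 'i, 'a) strategy) \<Rightarrow> bool" where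
  "eps_episodic_equilibrium G \<gamma> M s \<epsilon> \<pi> \<longleftrightarrow>
     eps_nash_equilibrium G \<gamma> s \<epsilon> \<pi> \<and>
     (\<forall>i. \<exists>\<sigma> \<in> episodic_strategies G M i. \<forall>h \<in> histories G. \<pi> i h = play_episodic M \<sigma> h)"

definition fin_utility_spread ::
    "('s::finite, 'i::finite, 'a) game \<Rightarrow> ('i \<Rightarrow> real) \<Rightarrow> nat \<Rightarrow>
     ('i \<Rightarrow> ('s, 'i, 'a) strategy) \<Rightarrow> 'i \<Rightarrow> real" where
  "fin_utility_spread G \<gamma> M \<pi> i =
     (MAX s. fin_utility G \<gamma> M \<pi> i s) - (MIN s. fin_utility G \<gamma> M \<pi> i s)"

end

theory Submission
  imports Defs
begin

text \<open>
  Cut the play into blocks of length \<open>M\<close>. Within a block the other agents behave as in the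
  finite game, so whatever the past, a deviator earns in a block started in state \<open>x\<close> at most
  \<open>v x + e\<close>, where \<open>v\<close> is the finite-horizon utility of the given profile, while following
  the profile earns exactly \<open>v x\<close>. The starting states of two plays may differ in every block
  but the first, which costs at most the spread of \<open>v\<close>. Summing the discounted block gains over
  \<open>N\<close> blocks and normalizing bounds the gain by the claimed constant for every \<open>N\<close>. In the
  time-averaged case the utility of the profile exists by the mean ergodic theorem for the
  Markov chain of block starting states.
\<close>

section \<open>Convergence of averages\<close>

text \<open>The averages of \<open>v\<close> are bounded, so along a subsequence they converge to
  some \<open>w\<close>, which is fixed by \<open>P\<close>. Up to an arbitrarily small error
  \<open>v - w\<close> is a coboundary \<open>u - P u\<close>, and averages of coboundaries vanish
  in the limit, so the whole sequence converges to \<open>w\<close>.\<close>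

lemma mean_ergodic:
  fixes P :: "'v::euclidean_space \<Rightarrow> 'v"
  assumes lin: "linear P" and bnd: "\<And>n x. norm ((P ^^ n) x) \<le> C * norm x"
  shows "convergent (\<lambda>N. (1 / real N) *\<^sub>R (\<Sum>n<N. (P ^^ n) v))"
proof -
  define A where "A N x = (1 / real N) *\<^sub>R (\<Sum>n<N. (P ^^ n) x)" for N x
  have linP: "linear (P ^^ n)" for n
    by (induction n)
      (auto intro: linear_compose[OF _ lin, unfolded o_def] linear_id[unfolded id_def])
  have A_diff: "A N (x - y) = A N x - A N y" for N x y
    unfolding A_def by (simp add: linear_diff[OF linP] sum_subtractf scaleR_diff_right)
  have A_P: "A N (P x) = P (A N x)" for N x
    unfolding A_def
    by (simp add: linear_sum[OF lin] linear_cmul[OF lin] flip: funpow_swap1)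
  have A_bound: "norm (A N x) \<le> C * norm x" if "N > 0" for N x
  proof -
    have "norm (\<Sum>n<N. (P ^^ n) x) \<le> (\<Sum>n<N. C * norm x)"
      by (rule order_trans[OF norm_sum sum_mono]) (rule bnd)
    then show ?thesis using that by (simp add: A_def field_simps)
  qed
  have A_coboundary: "A N (x - P x) = (1 / real N) *\<^sub>R (x - (P ^^ N) x)" for N x
  proof -
    have "(\<Sum>n<N. (P ^^ n) (x - P x)) = (\<Sum>n<N. (P ^^ n) x - (P ^^ Suc n) x)"
      by (simp add: linear_diff[OF linP] funpow_swap1)
    also have "\<dots> = x - (P ^^ N) x"
      by (subst sum_lessThan_telescope') simp
    finally show ?thesis by (simp add: A_def)
  qed
  have coboundary_null: "(\<lambda>N. A N (x - P x)) \<longlonglongrightarrow> 0" for x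
  proof (rule Lim_null_comparison)
    have "norm (x - (P ^^ N) x) \<le> norm x + C * norm x" for N
      using norm_triangle_ineq4[of x "(P ^^ N) x"] bnd[of N x] by simp
    then show "\<forall>\<^sub>F N in sequentially. norm (A N (x - P x)) \<le> (norm x + C * norm x) / real N"
      by (auto simp: A_coboundary divide_right_mono)
    show "(\<lambda>N. (norm x + C * norm x) / real N) \<longlonglongrightarrow> 0"
      by (rule lim_const_over_n)
  qed
  \<comment> \<open>The shift by one keeps every index positive: \<open>A 0 v\<close> is
    \<open>0\<close> by the convention for division by zero and is no average.\<close>
  have "bounded (range (\<lambda>N. A (Suc N) v))"
    by (rule boundedI[of _ "C * norm v"]) (auto intro: A_bound)
  from bounded_imp_convergent_subsequence[OF this]
  obtain w r where r: "strict_mono r" and w: "((\<lambda>N. A (Suc N) v) \<circ> r) \<longlonglongrightarrow> w"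
    by blast
  define q where "q k = Suc (r k)" for k
  have q: "strict_mono q" and w: "(\<lambda>k. A (q k) v) \<longlonglongrightarrow> w"
    using r w by (auto simp: q_def strict_mono_def o_def)
  \<comment> \<open>This difference equals \<open>A (q k) (v - P v)\<close>, the average of a
    coboundary, so it also tends to \<open>0\<close>.\<close>
  have "(\<lambda>k. A (q k) v - P (A (q k) v)) \<longlonglongrightarrow> w - P w"
    using lin by (intro tendsto_diff w bounded_linear.tendsto[of P])
      (simp add: linear_conv_bounded_linear)
  moreover have "(\<lambda>k. A (q k) v - P (A (q k) v)) \<longlonglongrightarrow> 0"
    using LIMSEQ_subseq_LIMSEQ[OF coboundary_null[of v] q] by (simp add: o_def A_diff A_P)
  ultimately have Pw: "P w = w"
    using LIMSEQ_unique by fastforce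
  have "(P ^^ n) w = w" for n by (induction n) (auto simp: Pw)
  then have A_w: "A N w = w" if "N > 0" for N
    using that by (simp add: A_def sum_constant_scaleR)
  have diff_coboundary: "\<exists>u. v - A n v = u - P u" if "n > 0" for n
  proof -
    \<comment> \<open>Each \<open>v - (P ^^ k) v\<close> is the coboundary of the partial sum of the
      first \<open>k\<close> iterates; averaging these partial sums over \<open>k < n\<close> gives
      the witness.\<close>
    define u where "u = (1 / real n) *\<^sub>R (\<Sum>k<n. \<Sum>j<k. (P ^^ j) v)"
    have "(\<Sum>j<k. (P ^^ j) v) - P (\<Sum>j<k. (P ^^ j) v) = v - (P ^^ k) v" for k
    proof -
      have "(\<Sum>j<k. (P ^^ j) v) - P (\<Sum>j<k. (P ^^ j) v) = (\<Sum>j<k. (P ^^ j) v - (P ^^ Suc j) v)"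
        by (simp add: linear_sum[OF lin] sum_subtractf)
      also have "\<dots> = v - (P ^^ k) v"
        by (subst sum_lessThan_telescope') simp
      finally show ?thesis .
    qed
    then have "u - P u = (1 / real n) *\<^sub>R (\<Sum>k<n. v - (P ^^ k) v)"
      by (simp add: u_def linear_cmul[OF lin] linear_sum[OF lin, of _ "{..<n}"]
          flip: scaleR_diff_right sum_subtractf)
    also have "\<dots> = v - A n v"
      using that by (simp add: A_def sum_subtractf scaleR_diff_right sum_constant_scaleR)
    finally show ?thesis by metis
  qed
  have "(\<lambda>N. A N v) \<longlonglongrightarrow> w"
  proof (rule LIMSEQ_I)
    fix e :: real assume e: "e > 0"
    have "(\<lambda>k. C * norm (A (q k) v - w)) \<longlonglongrightarrow> C * norm (w - w)"
      by (intro tendsto_intros w)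
    then obtain k where k: "C * norm (A (q k) v - w) < e / 2"
      using order_tendstoD(2)[of _ "C * norm (w - w)" sequentially "e/2"] e
      by (force simp: eventually_sequentially)
    obtain u where u: "v - A (q k) v = u - P u"
      using diff_coboundary[of "q k"] by (auto simp: q_def)
    obtain N0 where N0: "\<And>N. N \<ge> N0 \<Longrightarrow> norm (A N (u - P u)) < e / 2"
      using LIMSEQ_D[OF coboundary_null[of u], of "e/2"] e by auto
    have "norm (A N v - w) < e" if "N \<ge> Suc N0" for N
    proof -
      \<comment> \<open>The index \<open>k\<close> is fixed before \<open>N\<close> grows: the first
        summand vanishes as \<open>N\<close> grows, and \<open>A_bound\<close> keeps the second
        below \<open>e / 2\<close> for every positive \<open>N\<close>.\<close>
      have "A N v - w = A N ((u - P u) + (A (q k) v - w))"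
        using that by (simp add: A_diff A_w flip: u)
      also have "\<dots> = A N (u - P u) + A N (A (q k) v - w)"
        using A_diff[of N "(u - P u) + (A (q k) v - w)" "A (q k) v - w"] by simp
      finally have "norm (A N v - w) \<le> norm (A N (u - P u)) + norm (A N (A (q k) v - w))"
        by (simp add: norm_triangle_ineq)
      moreover have "norm (A N (A (q k) v - w)) \<le> C * norm (A (q k) v - w)"
        using that by (intro A_bound) auto
      ultimately show ?thesis using k N0[of N] that by simp
    qed
    then show "\<exists>N0. \<forall>N\<ge>N0. norm (A N v - w) < e" by blast
  qed
  then show ?thesis by (auto simp: A_def convergent_def)
qed

text \<open>Rounding \<open>n\<close> down to a multiple of \<open>M\<close> changes
  \<open>a n\<close> by at most \<open>M * B\<close>, which disappears after division by
  \<open>n\<close>, while \<open>(n div M) / n\<close> tends to \<open>1 / M\<close>. This passes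
  from whole blocks to arbitrary horizons.\<close>

lemma convergent_average_of_blocks:
  fixes a :: "nat \<Rightarrow> real"
  assumes M: "M > 0" and inc: "\<And>n. \<bar>a (Suc n) - a n\<bar> \<le> B"
    and blocks: "convergent (\<lambda>q. a (q * M) / real q)"
  shows "convergent (\<lambda>n. a n / real n)"
proof -
  obtain L where L: "(\<lambda>q. a (q * M) / real q) \<longlonglongrightarrow> L"
    using blocks by (auto simp: convergent_def)
  have add: "\<bar>a (n + m) - a n\<bar> \<le> real m * B" for n m
  proof (induction m)
    case (Suc m)
    then show ?case using inc[of "n + m"] by (simp add: algebra_simps)
  qed simp
  have B: "B \<ge> 0" using inc[of 0] by linarith
  have div: "filterlim (\<lambda>n. n div M) at_top sequentially"
    unfolding filterlim_at_top
  proof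
    fix Z show "\<forall>\<^sub>F n in sequentially. Z \<le> n div M"
      using M by (intro eventually_sequentiallyI[of "Z * M"])
        (simp add: less_eq_div_iff_mult_less_eq)
  qed
  have diff0: "(\<lambda>n. c n / real n) \<longlonglongrightarrow> 0" if "\<And>n. \<bar>c n\<bar> \<le> D" for c :: "nat \<Rightarrow> real" and D
  proof (rule Lim_null_comparison)
    show "\<forall>\<^sub>F n in sequentially. norm (c n / real n) \<le> D / real n"
      using that by (intro always_eventually) (auto simp: divide_right_mono)
    show "(\<lambda>n. D / real n) \<longlonglongrightarrow> 0" by (rule lim_const_over_n)
  qed
  have r: "(\<lambda>n. (a n - a (n div M * M)) / real n) \<longlonglongrightarrow> 0"
  proof (rule diff0)
    fix n
    have "\<bar>a n - a (n div M * M)\<bar> \<le> real (n mod M) * B"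
      using add[of "n div M * M" "n mod M"] by simp
    also have "\<dots> \<le> real M * B"
      using M B by (intro mult_right_mono) (auto intro: less_imp_le)
    finally show "\<bar>a n - a (n div M * M)\<bar> \<le> real M * B" .
  qed
  have "(\<lambda>n. real (n mod M) / real n) \<longlonglongrightarrow> 0"
    by (rule diff0[of _ "real M"]) (use M in \<open>auto intro: less_imp_le\<close>)
  then have "(\<lambda>n. (1 - real (n mod M) / real n) / real M) \<longlonglongrightarrow> (1 - 0) / real M"
    by (intro tendsto_intros) (use M in auto)
  moreover have "\<forall>\<^sub>F n in sequentially.
      (1 - real (n mod M) / real n) / real M = real (n div M) / real n"
  proof (rule eventually_sequentiallyI[of 1])
    fix n :: nat assume "1 \<le> n"
    have "real (n div M * M + n mod M) = real n"
      by (simp only: div_mult_mod_eq)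
    then have "real n - real (n mod M) = real (n div M) * real M"
      by (simp only: of_nat_add of_nat_mult)
    moreover have "1 - real (n mod M) / real n = (real n - real (n mod M)) / real n"
      using \<open>1 \<le> n\<close> by (simp add: diff_divide_distrib)
    ultimately show "(1 - real (n mod M) / real n) / real M = real (n div M) / real n"
      using M by simp
  qed
  ultimately have q: "(\<lambda>n. real (n div M) / real n) \<longlonglongrightarrow> 1 / real M"
    using Lim_transform_eventually[of "\<lambda>n. (1 - real (n mod M) / real n) / real M"] by force
  have "(\<lambda>n. a (n div M * M) / real (n div M) * (real (n div M) / real n)
      + (a n - a (n div M * M)) / real n) \<longlonglongrightarrow> L * (1 / real M) + 0"
    by (intro tendsto_add tendsto_mult q r filterlim_compose[OF L div])
  moreover have "\<forall>\<^sub>F n in sequentially.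
      a (n div M * M) / real (n div M) * (real (n div M) / real n)
      + (a n - a (n div M * M)) / real n = a n / real n"
  \<comment> \<open>From \<open>M\<close> on the number of blocks is positive and cancels.\<close>
  proof (rule eventually_sequentiallyI[of M])
    fix n assume "M \<le> n"
    then have "n div M > 0" using M by (simp add: div_greater_zero_iff)
    then show "a (n div M * M) / real (n div M) * (real (n div M) / real n)
      + (a n - a (n div M * M)) / real n = a n / real n"
      by (simp add: diff_divide_distrib)
  qed
  ultimately show ?thesis
    unfolding convergent_def by (blast intro: Lim_transform_eventually)
qed

text \<open>The increments telescope and are dominated by a geometric series. In the discounted case
  \<open>a n\<close> will be the expected return over \<open>n\<close> stages.\<close>

lemma convergent_of_geometric_increments:
  fixes a :: "nat \<Rightarrow> real"
  assumes "0 \<le> g" "g < 1" and inc: "\<And>n. \<bar>a (Suc n) - a n\<bar> \<le> B * g ^ n"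
  shows "convergent a"
proof -
  have "summable (\<lambda>n. a (Suc n) - a n)"
    by (rule summable_comparison_test'[of "\<lambda>n. B * g ^ n"])
      (use assms in \<open>auto intro: summable_mult summable_geometric\<close>)
  then have "convergent (\<lambda>n. \<Sum>k<n. a (Suc k) - a k)"
    by (simp add: summable_iff_convergent)
  then have "convergent (\<lambda>n. (a n - a 0) + a 0)"
    by (simp only: sum_lessThan_telescope convergent_add_const_right_iff)
  then show ?thesis by simp
qed

section \<open>Block sums and expectations under finitely supported laws\<close>

lemma sum_lessThan_add:
  fixes f :: "nat \<Rightarrow> 'b::comm_monoid_add"
  shows "(\<Sum>k<n + m. f k) = (\<Sum>k<n. f k) + (\<Sum>k<m. f (n + k))"
  by (induction m) (simp_all add: add.assoc)

text \<open>Every stage is uniquely \<open>n * M + j\<close> with \<open>j < M\<close>. This factors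
  the normalizing constant at the end of a block.\<close>

lemma power_sum_blocks:
  fixes g :: "'b::comm_semiring_1"
  shows "(\<Sum>k<N * M. g ^ k) = (\<Sum>n<N. (g ^ M) ^ n) * (\<Sum>k<M. g ^ k)"
proof (induction N)
  case (Suc N)
  have "(\<Sum>k<N * M + M. g ^ k) = (\<Sum>k<N * M. g ^ k) + (g ^ M) ^ N * (\<Sum>k<M. g ^ k)"
    by (simp add: sum_lessThan_add power_add sum_distrib_left mult.commute[of N] power_mult)
  then show ?case using Suc.IH by (simp add: algebra_simps)
qed simp

lemma expectation_cong:
  fixes f g :: "'b \<Rightarrow> real"
  assumes "\<And>x. x \<in> set_pmf p \<Longrightarrow> f x = g x"
  shows "measure_pmf.expectation p f = measure_pmf.expectation p g"
  using assms by (intro integral_cong_AE) (auto simp: AE_measure_pmf_iff)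

lemma expectation_le:
  fixes f :: "'b \<Rightarrow> real"
  assumes "finite (set_pmf p)" "\<And>x. x \<in> set_pmf p \<Longrightarrow> f x \<le> c"
  shows "measure_pmf.expectation p f \<le> c"
  using assms
  by (intro measure_pmf.integral_le_const integrable_measure_pmf_finite)
    (auto simp: AE_measure_pmf_iff)

lemma expectation_ge:
  fixes f :: "'b \<Rightarrow> real"
  assumes "finite (set_pmf p)" "\<And>x. x \<in> set_pmf p \<Longrightarrow> c \<le> f x"
  shows "c \<le> measure_pmf.expectation p f"
  using assms
  by (intro measure_pmf.integral_ge_const integrable_measure_pmf_finite)
    (auto simp: AE_measure_pmf_iff)

lemma expectation_abs_le:
  fixes f :: "'b \<Rightarrow> real"
  assumes "finite (set_pmf p)" "\<And>x. x \<in> set_pmf p \<Longrightarrow> \<bar>f x\<bar> \<le> c"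
  shows "\<bar>measure_pmf.expectation p f\<bar> \<le> c"
  using expectation_le[of p f c] expectation_ge[of p "- c" f] assms
  by (simp add: abs_le_iff minus_le_iff)

lemma expectation_bind_finite:
  fixes h :: "'c \<Rightarrow> real"
  assumes "finite (set_pmf p)" "\<And>x. x \<in> set_pmf p \<Longrightarrow> finite (set_pmf (f x))"
  shows "measure_pmf.expectation (bind_pmf p f) h =
    measure_pmf.expectation p (\<lambda>x. measure_pmf.expectation (f x) h)"
  using assms
  by (simp add: pmf_expectation_bind[of "set_pmf p"] integral_measure_pmf_real[of "set_pmf p"]
      mult.commute)

section \<open>Splitting a play into a past and its continuation\<close>

text \<open>The current state \<open>snd h\<close> is dropped because it is the initial state of
  \<open>h'\<close>, which already records it. The result is a meaningful play only when
  \<open>h'\<close> starts in \<open>snd h\<close>.\<close>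

definition prepend ::
    "('s, 'i, 'a) history \<Rightarrow> ('s, 'i, 'a) history \<Rightarrow> ('s, 'i, 'a) history" where
  "prepend h h' = (fst h @ fst h', snd h')"

definition continuation ::
    "('i \<Rightarrow> ('s, 'i, 'a) strategy) \<Rightarrow> ('s, 'i, 'a) history \<Rightarrow> 'i \<Rightarrow> ('s, 'i, 'a) strategy" where
  "continuation \<pi> h i h' = \<pi> i (prepend h h')"

lemma snd_prepend [simp]: "snd (prepend h h') = snd h'"
  by (simp add: prepend_def)

lemma stage_prepend [simp]: "stage (prepend h h') = stage h + stage h'"
  by (simp add: prepend_def stage_def)

lemma prepend_in_histories:
  "h \<in> histories G \<Longrightarrow> h' \<in> histories G \<Longrightarrow> prepend h h' \<in> histories G"
  by (auto simp: histories_def prepend_def)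

lemma stage_history_law: "h \<in> set_pmf (history_law G \<pi> s n) \<Longrightarrow> stage h = n"
  by (induction n arbitrary: h) (auto simp: stage_def)

text \<open>Only decisions at stages before \<open>n\<close> enter the law. Profiles that agree
  merely within one block can therefore be exchanged there.\<close>

lemma history_law_cong:
  assumes "\<And>i h. stage h < n \<Longrightarrow> \<pi> i h = \<pi>' i h"
  shows "history_law G \<pi> s n = history_law G \<pi>' s n"
  using assms
proof (induction n)
  case (Suc n)
  have IH: "history_law G \<pi> s n = history_law G \<pi>' s n"
    by (rule Suc.IH) (simp add: Suc.prems)
  show ?case
    unfolding history_law.simps IH
  proof (rule bind_pmf_cong[OF refl])
    fix h assume "h \<in> set_pmf (history_law G \<pi>' s n)"
    then have "(\<lambda>i. \<pi> i h) = (\<lambda>i. \<pi>' i h)"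
      by (simp add: Suc.prems stage_history_law)
    then show "bind_pmf (Pi_pmf UNIV undefined (\<lambda>i. \<pi> i h)) (\<lambda>a. bind_pmf (trans G (snd h) a)
        (\<lambda>y. return_pmf (fst h @ [(snd h, a)], y))) =
      bind_pmf (Pi_pmf UNIV undefined (\<lambda>i. \<pi>' i h)) (\<lambda>a. bind_pmf (trans G (snd h) a)
        (\<lambda>y. return_pmf (fst h @ [(snd h, a)], y)))"
      by (simp only:)
  qed
qed simp

lemma expected_return_cong:
  assumes "\<And>i h. stage h < n \<Longrightarrow> \<pi> i h = \<pi>' i h"
  shows "expected_return G \<gamma> n \<pi> i s = expected_return G \<gamma> n \<pi>' i s"
proof -
  have "history_law G \<pi> s n = history_law G \<pi>' s n"
    by (rule history_law_cong) (rule assms)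
  then show ?thesis by (simp only: expected_return_def)
qed

text \<open>Restarting after the past \<open>h\<close> from its current state, with strategies that
  remember \<open>h\<close>, reproduces the play; the induction uses only associativity of
  \<open>bind_pmf\<close>.\<close>

lemma history_law_add:
  "history_law G \<pi> s (n + m) = bind_pmf (history_law G \<pi> s n)
     (\<lambda>h. map_pmf (prepend h) (history_law G (continuation \<pi> h) (snd h) m))"
proof (induction m)
  case 0
  show ?case by (simp add: prepend_def bind_return_pmf')
next
  case (Suc m)
  then show ?case
    by (simp add: map_pmf_def bind_assoc_pmf bind_return_pmf continuation_def prepend_def)
qed

lemma finite_joint_actions:
  fixes G :: "('s::finite, 'i::finite, 'a) game"
  assumes "stochastic_game G"
  shows "finite (joint_actions G)"
proof -
  have "joint_actions G = PiE UNIV (act G)" by (auto simp: joint_actions_def PiE_def)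
  then show ?thesis using assms by (auto simp: stochastic_game_def intro: finite_PiE)
qed

lemma finite_histories:
  fixes G :: "('s::finite, 'i::finite, 'a) game"
  assumes "stochastic_game G"
  shows "finite {h \<in> histories G. stage h = n}"
proof (rule finite_subset)
  show "{h \<in> histories G. stage h = n}
    \<subseteq> {xs. set xs \<subseteq> UNIV \<times> joint_actions G \<and> length xs = n} \<times> UNIV"
    by (auto simp: histories_def stage_def)
  show "finite ({xs. set xs \<subseteq> (UNIV :: 's set) \<times> joint_actions G \<and> length xs = n}
      \<times> (UNIV :: 's set))"
    by (intro finite_cartesian_product finite_lists_length_eq finite_joint_actions assms) auto
qed

text \<open>Strategies are constrained only on \<open>histories G\<close>, so legality of the past
  and legality of the next actions have to be established together by induction.\<close>

lemma history_law_support: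
  assumes "\<And>i. \<pi> i \<in> fin_strategies G n i"
  shows "set_pmf (history_law G \<pi> s n) \<subseteq> {h \<in> histories G. stage h = n}"
  using assms
proof (induction n)
  case 0
  then show ?case by (simp add: histories_def stage_def)
next
  case (Suc n)
  have "\<pi> i \<in> fin_strategies G n i" for i
    using Suc.prems[of i] by (auto simp: fin_strategies_def)
  then have IH: "set_pmf (history_law G \<pi> s n) \<subseteq> {h \<in> histories G. stage h = n}"
    by (rule Suc.IH)
  show ?case
  proof
    fix h' assume "h' \<in> set_pmf (history_law G \<pi> s (Suc n))"
    then obtain h a y where h: "h \<in> set_pmf (history_law G \<pi> s n)"
      and a: "a \<in> set_pmf (Pi_pmf UNIV undefined (\<lambda>i. \<pi> i h))"
      and h': "h' = (fst h @ [(snd h, a)], y)"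
      by auto
    have "a i \<in> act G i" for i
    proof -
      have "a i \<in> set_pmf (\<pi> i h)"
        using a by (auto simp: set_Pi_pmf PiE_dflt_def)
      then show ?thesis
        using Suc.prems[of i] h IH by (fastforce simp: fin_strategies_def)
    qed
    then have "a \<in> joint_actions G" by (simp add: joint_actions_def)
    moreover have "h \<in> histories G" "stage h = n" using h IH by auto
    ultimately show "h' \<in> {h \<in> histories G. stage h = Suc n}"
      by (auto simp: h' histories_def stage_def)
  qed
qed

lemma finite_history_law:
  fixes G :: "('s::finite, 'i::finite, 'a) game"
  assumes "stochastic_game G" "\<And>i. \<pi> i \<in> fin_strategies G n i"
  shows "finite (set_pmf (history_law G \<pi> s n))"
  using finite_subset[OF history_law_support finite_histories] assms by blast

lemma fin_strategies_mono: "n \<le> m \<Longrightarrow> fin_strategies G m i \<subseteq> fin_strategies G n i"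
  by (auto simp: fin_strategies_def)

lemma strategies_subset_fin_strategies: "strategies G i \<subseteq> fin_strategies G n i"
  by (auto simp: fin_strategies_def strategies_def)

lemma continuation_fin_strategies:
  assumes "\<pi> i \<in> fin_strategies G (n + m) i" "h \<in> histories G" "stage h = n"
  shows "continuation \<pi> h i \<in> fin_strategies G m i"
  using assms by (auto simp: fin_strategies_def continuation_def prepend_in_histories)

lemma expectation_history_law_add:
  fixes G :: "('s::finite, 'i::finite, 'a) game" and f :: "('s, 'i, 'a) history \<Rightarrow> real"
  assumes G: "stochastic_game G" and \<pi>: "\<And>i. \<pi> i \<in> fin_strategies G (n + m) i"
  shows "measure_pmf.expectation (history_law G \<pi> s (n + m)) f =
    measure_pmf.expectation (history_law G \<pi> s n) (\<lambda>h.
      measure_pmf.expectation (history_law G (continuation \<pi> h) (snd h) m) (\<lambda>h'. f (prepend h h')))"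
proof -
  have \<pi>': "\<pi> i \<in> fin_strategies G n i" for i
    by (rule subsetD[OF fin_strategies_mono \<pi>]) simp
  show ?thesis
    unfolding history_law_add
  proof (subst expectation_bind_finite)
    fix h assume "h \<in> set_pmf (history_law G \<pi> s n)"
    then have "h \<in> histories G" "stage h = n"
      using history_law_support[OF \<pi>'] by auto
    then have "continuation \<pi> h i \<in> fin_strategies G m i" for i
      by (intro continuation_fin_strategies[where n = n] \<pi>)
    then show "finite (set_pmf (map_pmf (prepend h) (history_law G (continuation \<pi> h) (snd h) m)))"
      using finite_history_law[OF G] by auto
  qed (auto intro: finite_history_law[OF G \<pi>'])
qed

text \<open>The reward at stage \<open>n + k\<close> is the stage-\<open>k\<close> reward of the
  continuation, discounted by a further \<open>\<gamma> i ^ n\<close>; conditioning on the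
  stage-\<open>n\<close> history does the rest.\<close>

lemma expected_return_add:
  fixes G :: "('s::finite, 'i::finite, 'a) game"
  assumes G: "stochastic_game G" and \<pi>: "\<And>i. \<pi> i \<in> fin_strategies G (n + m) i"
  shows "expected_return G \<gamma> (n + m) \<pi> i s = expected_return G \<gamma> n \<pi> i s +
    \<gamma> i ^ n * measure_pmf.expectation (history_law G \<pi> s n)
      (\<lambda>h. expected_return G \<gamma> m (continuation \<pi> h) i (snd h))"
proof -
  let ?R = "\<lambda>n h. \<Sum>k<n. \<gamma> i ^ k * rew G i (fst (fst h ! k)) (snd (fst h ! k))"
  let ?E = "\<lambda>h. expected_return G \<gamma> m (continuation \<pi> h) i (snd h)"
  have \<pi>': "\<pi> i \<in> fin_strategies G n i" for i
    by (rule subsetD[OF fin_strategies_mono \<pi>]) simp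
  have int: "integrable (history_law G \<pi> s n) f" for f :: "('s, 'i, 'a) history \<Rightarrow> real"
    by (intro integrable_measure_pmf_finite finite_history_law[OF G \<pi>'])
  have "expected_return G \<gamma> (n + m) \<pi> i s =
    measure_pmf.expectation (history_law G \<pi> s n) (\<lambda>h.
      measure_pmf.expectation (history_law G (continuation \<pi> h) (snd h) m)
        (\<lambda>h'. ?R (n + m) (prepend h h')))"
    unfolding expected_return_def by (rule expectation_history_law_add[OF G \<pi>])
  also have "\<dots> = measure_pmf.expectation (history_law G \<pi> s n) (\<lambda>h. ?R n h + \<gamma> i ^ n * ?E h)"
  proof (rule expectation_cong)
    fix h assume "h \<in> set_pmf (history_law G \<pi> s n)"
    then have h: "h \<in> histories G" "stage h = n"
      using history_law_support[OF \<pi>'] by auto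
    have "continuation \<pi> h i \<in> fin_strategies G m i" for i
      by (intro continuation_fin_strategies[where n = n] \<pi> h)
    then have int: "integrable (history_law G (continuation \<pi> h) (snd h) m) f"
      for f :: "('s, 'i, 'a) history \<Rightarrow> real"
      by (intro integrable_measure_pmf_finite finite_history_law[OF G])
    \<comment> \<open>The first \<open>n\<close> rewards depend on \<open>h\<close> alone and are
      constant for the inner expectation.\<close>
    have "?R (n + m) (prepend h h') = ?R n h + \<gamma> i ^ n * ?R m h'" for h'
    proof -
      have "?R (n + m) (prepend h h') =
        (\<Sum>k<n. \<gamma> i ^ k * rew G i (fst (fst (prepend h h') ! k)) (snd (fst (prepend h h') ! k))) +
        (\<Sum>k<m. \<gamma> i ^ (n + k) *
          rew G i (fst (fst (prepend h h') ! (n + k))) (snd (fst (prepend h h') ! (n + k))))"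
        by (rule sum_lessThan_add)
      also have "\<dots> = ?R n h + \<gamma> i ^ n * ?R m h'"
        using h by (simp add: prepend_def stage_def nth_append power_add sum_distrib_left mult.assoc)
      finally show ?thesis .
    qed
    then show "measure_pmf.expectation (history_law G (continuation \<pi> h) (snd h) m)
        (\<lambda>h'. ?R (n + m) (prepend h h')) = ?R n h + \<gamma> i ^ n * ?E h"
      by (simp only: expected_return_def Bochner_Integration.integral_add[OF int int]
          integral_mult_right_zero) simp
  qed
  also have "\<dots> = expected_return G \<gamma> n \<pi> i s +
    \<gamma> i ^ n * measure_pmf.expectation (history_law G \<pi> s n) ?E"
    by (simp only: expected_return_def Bochner_Integration.integral_add[OF int int]
          integral_mult_right_zero)
  finally show ?thesis .
qed

text \<open>One more stage adds a discounted one-stage return of a continuation, and rewards are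
  bounded since states and joint actions are finite. The bound \<open>B\<close> is chosen before
  \<open>\<pi>\<close>, \<open>s\<close> and \<open>n\<close>.\<close>

lemma expected_return_increment:
  fixes G :: "('s::finite, 'i::finite, 'a) game"
  assumes G: "stochastic_game G" and \<gamma>: "0 \<le> \<gamma> i"
  shows "\<exists>B. \<forall>\<pi> s n. (\<forall>j. \<pi> j \<in> strategies G j) \<longrightarrow>
    \<bar>expected_return G \<gamma> (Suc n) \<pi> i s - expected_return G \<gamma> n \<pi> i s\<bar> \<le> B * \<gamma> i ^ n"
proof -
  define X where "X = (\<lambda>(x, a). \<bar>rew G i x a\<bar>) ` (UNIV \<times> joint_actions G)"
  define B where "B = Max X"
  have "finite X" unfolding X_def using finite_joint_actions[OF G] by simp
  then have B: "\<bar>rew G i x a\<bar> \<le> B" if "a \<in> joint_actions G" for x a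
    unfolding B_def using that by (intro Max_ge) (auto simp: X_def image_iff)
  have one: "\<bar>expected_return G \<gamma> 1 \<pi> i x\<bar> \<le> B"
    if \<pi>: "\<And>j. \<pi> j \<in> fin_strategies G 1 j" for \<pi> x
    unfolding expected_return_def
  proof (rule expectation_abs_le)
    show "finite (set_pmf (history_law G \<pi> x 1))"
      by (rule finite_history_law[OF G \<pi>])
    fix h assume "h \<in> set_pmf (history_law G \<pi> x 1)"
    then have "h \<in> histories G" "stage h = 1"
      using history_law_support[OF \<pi>] by blast+
    then show "\<bar>\<Sum>k<1. \<gamma> i ^ k * rew G i (fst (fst h ! k)) (snd (fst h ! k))\<bar> \<le> B"
      using B by (auto simp: histories_def stage_def length_Suc_conv)
  qed
  have "\<bar>expected_return G \<gamma> (Suc n) \<pi> i s - expected_return G \<gamma> n \<pi> i s\<bar> \<le> B * \<gamma> i ^ n"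
    if "\<forall>j. \<pi> j \<in> strategies G j" for \<pi> s n
  proof -
    have \<pi>: "\<pi> j \<in> fin_strategies G k j" for j k
      by (rule subsetD[OF strategies_subset_fin_strategies]) (simp add: that)
    have "\<bar>measure_pmf.expectation (history_law G \<pi> s n)
      (\<lambda>h. expected_return G \<gamma> 1 (continuation \<pi> h) i (snd h))\<bar> \<le> B"
    proof (rule expectation_abs_le)
      fix h assume "h \<in> set_pmf (history_law G \<pi> s n)"
      then have "h \<in> histories G" "stage h = n"
        using history_law_support[OF \<pi>] by auto
      then show "\<bar>expected_return G \<gamma> 1 (continuation \<pi> h) i (snd h)\<bar> \<le> B"
        by (intro one continuation_fin_strategies \<pi>)
    qed (rule finite_history_law[OF G \<pi>])
    then show ?thesis
      using expected_return_add[OF G \<pi>, of \<gamma> n 1 i s] \<gamma>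
      by (simp add: abs_mult mult.commute[of B] mult_left_mono)
  qed
  then show ?thesis by blast
qed

lemma fin_utility_bounds:
  "fin_utility G \<gamma> M \<pi> i x \<le> (MAX y. fin_utility G \<gamma> M \<pi> i y)"
  "(MIN y. fin_utility G \<gamma> M \<pi> i y) \<le> fin_utility G \<gamma> M \<pi> i x"
  for G :: "('s::finite, 'i::finite, 'a) game"
  by auto

lemma fin_utility_spread_nonneg: "0 \<le> fin_utility_spread G \<gamma> M \<pi> i"
  using fin_utility_bounds[where x = undefined] order_trans
  by (fastforce simp: fin_utility_spread_def)

section \<open>Block decomposition of episodic play and of deviations from it\<close>

context
  fixes G :: "('s::finite, 'i::finite, 'a) game" and M :: nat
    and \<pi>bar :: "'i \<Rightarrow> 's \<Rightarrow> nat \<Rightarrow> 'a pmf"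
  assumes G: "stochastic_game G" and M: "M > 0"
    and \<pi>bar: "\<And>i. \<pi>bar i \<in> episodic_strategies G M i"
begin

abbreviation (input) "episodic \<equiv> \<lambda>i. play_episodic M (\<pi>bar i) :: ('s, 'i, 'a) strategy"
abbreviation (input) "markov \<equiv> \<lambda>i. play_markov (\<pi>bar i) :: ('s, 'i, 'a) strategy"

lemma episodic_profile_strategies: "episodic i \<in> strategies G i"
  using \<pi>bar[of i] M by (auto simp: strategies_def episodic_strategies_def play_episodic_def)

lemma episodic_profile_fin_strategies: "episodic i \<in> fin_strategies G n i"
  by (rule subsetD[OF strategies_subset_fin_strategies episodic_profile_strategies])

lemma markov_profile_fin_strategies: "markov i \<in> fin_strategies G M i"
  using \<pi>bar[of i] by (auto simp: fin_strategies_def episodic_strategies_def play_markov_def)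

text \<open>A past made of whole blocks does not change the stage modulo \<open>M\<close>. The bound
  on \<open>stage h'\<close> is needed because \<open>play_markov\<close> does not reduce the
  stage.\<close>

lemma continuation_episodic_profile:
  assumes "stage h = n * M" "stage h' < M"
  shows "continuation episodic h j h' = markov j h'"
  using assms by (simp add: continuation_def play_episodic_def play_markov_def)

lemma expected_return_episodic_profile_block:
  "expected_return G \<gamma> (n * M + M) episodic i s = expected_return G \<gamma> (n * M) episodic i s +
    \<gamma> i ^ (n * M) * measure_pmf.expectation (history_law G episodic s (n * M))
      (\<lambda>h. fin_utility G \<gamma> M markov i (snd h))"
  unfolding expected_return_add[OF G episodic_profile_fin_strategies] fin_utility_def
  by (intro arg_cong2[of _ _ _ _ "(+)"] arg_cong2[of _ _ _ _ "(*)"] refl expectation_cong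
      expected_return_cong continuation_episodic_profile stage_history_law)

text \<open>After each fixed past the deviator's continuation is a legal finite-horizon strategy,
  and the others play their Markov strategies. As \<open>opt\<close> covers history-dependent
  strategies and all initial states, it applies past by past; \<open>c\<close> then bounds the
  values of the states reached.\<close>

lemma expected_return_deviation_block:
  assumes \<sigma>: "\<sigma> \<in> strategies G i" and \<gamma>: "0 \<le> \<gamma> i"
    and opt: "\<And>x \<pi>hat. \<pi>hat \<in> fin_strategies G M i \<Longrightarrow>
      fin_utility G \<gamma> M (markov(i := \<pi>hat)) i x \<le> fin_utility G \<gamma> M markov i x + e"
    and bnd: "\<And>h. h \<in> set_pmf (history_law G (episodic(i := \<sigma>)) s (n * M)) \<Longrightarrow>
      fin_utility G \<gamma> M markov i (snd h) \<le> c"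
  shows "expected_return G \<gamma> (n * M + M) (episodic(i := \<sigma>)) i s \<le>
    expected_return G \<gamma> (n * M) (episodic(i := \<sigma>)) i s + \<gamma> i ^ (n * M) * (c + e)"
proof -
  let ?\<pi> = "episodic(i := \<sigma>)"
  have \<pi>: "?\<pi> j \<in> fin_strategies G k j" for j k
    using episodic_profile_fin_strategies \<sigma> strategies_subset_fin_strategies by fastforce
  have "measure_pmf.expectation (history_law G ?\<pi> s (n * M))
      (\<lambda>h. expected_return G \<gamma> M (continuation ?\<pi> h) i (snd h)) \<le> c + e"
  proof (rule expectation_le)
    fix h assume h: "h \<in> set_pmf (history_law G ?\<pi> s (n * M))"
    then have h': "h \<in> histories G" "stage h = n * M"
      using history_law_support[OF \<pi>] by blast+
    have "expected_return G \<gamma> M (continuation ?\<pi> h) i (snd h) =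
      fin_utility G \<gamma> M (markov(i := continuation ?\<pi> h i)) i (snd h)"
      unfolding fin_utility_def
    proof (rule expected_return_cong)
      fix j and h' :: "('s, 'i, 'a) history" assume "stage h' < M"
      then show "continuation ?\<pi> h j h' = (markov(i := continuation ?\<pi> h i)) j h'"
        using continuation_episodic_profile[OF h'(2)] by (auto simp: continuation_def)
    qed
    also have "\<dots> \<le> fin_utility G \<gamma> M markov i (snd h) + e"
      by (intro opt continuation_fin_strategies[where n = "n * M"] \<pi> h')
    finally show "expected_return G \<gamma> M (continuation ?\<pi> h) i (snd h) \<le> c + e"
      using bnd[OF h] by simp
  qed (rule finite_history_law[OF G \<pi>])
  then show ?thesis
    unfolding expected_return_add[OF G \<pi>] using \<gamma> by (simp add: mult_left_mono)
qed

text \<open>Both plays start in the same state, so the spread is not paid in the first block.\<close>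

lemma deviation_gain:
  assumes \<sigma>: "\<sigma> \<in> strategies G i" and \<gamma>: "0 \<le> \<gamma> i"
    and opt: "\<And>x \<pi>hat. \<pi>hat \<in> fin_strategies G M i \<Longrightarrow>
      fin_utility G \<gamma> M (markov(i := \<pi>hat)) i x \<le> fin_utility G \<gamma> M markov i x + e"
  shows "expected_return G \<gamma> (N * M) (episodic(i := \<sigma>)) i s - expected_return G \<gamma> (N * M) episodic i s
    \<le> (\<Sum>n<N. \<gamma> i ^ (n * M) * (e + (if n = 0 then 0 else fin_utility_spread G \<gamma> M markov i)))"
proof (induction N)
  case 0
  then show ?case by (simp add: expected_return_def)
next
  case (Suc n)
  let ?v = "fin_utility G \<gamma> M markov i"
  \<comment> \<open>Bounds on the value of the state in which block \<open>n\<close> starts: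
    \<open>c\<close> from above under the deviation, \<open>d\<close> from below under the
    profile.\<close>
  define c where "c = (if n = 0 then ?v s else MAX y. ?v y)"
  define d where "d = (if n = 0 then ?v s else MIN y. ?v y)"
  have "expected_return G \<gamma> (n * M + M) (episodic(i := \<sigma>)) i s \<le>
    expected_return G \<gamma> (n * M) (episodic(i := \<sigma>)) i s + \<gamma> i ^ (n * M) * (c + e)"
    using \<sigma> \<gamma> opt
    by (rule expected_return_deviation_block) (auto simp: c_def fin_utility_bounds split: if_splits)
  moreover have "d \<le> measure_pmf.expectation (history_law G episodic s (n * M)) (\<lambda>h. ?v (snd h))"
    by (rule expectation_ge[OF finite_history_law[OF G episodic_profile_fin_strategies]])
      (auto simp: d_def fin_utility_bounds)
  then have "expected_return G \<gamma> (n * M) episodic i s + \<gamma> i ^ (n * M) * d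
      \<le> expected_return G \<gamma> (n * M + M) episodic i s"
    unfolding expected_return_episodic_profile_block using \<gamma> by (simp add: mult_left_mono)
  moreover have "c + e - d = e + (if n = 0 then 0 else fin_utility_spread G \<gamma> M markov i)"
    by (simp add: c_def d_def fin_utility_spread_def)
  then have "\<gamma> i ^ (n * M) * (e + (if n = 0 then 0 else fin_utility_spread G \<gamma> M markov i)) =
    \<gamma> i ^ (n * M) * (c + e) - \<gamma> i ^ (n * M) * d"
    by (metis right_diff_distrib)
  moreover have "Suc n * M = n * M + M" by simp
  ultimately show ?case using Suc.IH by (simp only: sum.lessThan_Suc)
qed

section \<open>The Markov chain of block starting states\<close>

text \<open>\<open>P\<close> is the transition operator of this chain, acting on functions of the
  state. They are encoded as vectors so that \<open>mean_ergodic\<close> applies.\<close>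

lemma expectation_block_state:
  fixes x :: "real ^ 's"
  defines "P \<equiv> \<lambda>x :: real ^ 's. \<chi> s. measure_pmf.expectation (history_law G markov s M) (\<lambda>h. x $ snd h)"
  shows "(P ^^ n) x $ s = measure_pmf.expectation (history_law G episodic s (n * M)) (\<lambda>h. x $ snd h)"
proof (induction n arbitrary: x)
  case (Suc n)
  have "measure_pmf.expectation (history_law G episodic s (n * M + M)) (\<lambda>h. x $ snd h) =
    measure_pmf.expectation (history_law G episodic s (n * M)) (\<lambda>h.
      measure_pmf.expectation (history_law G (continuation episodic h) (snd h) M) (\<lambda>h. x $ snd h))"
    by (simp add: expectation_history_law_add[OF G episodic_profile_fin_strategies])
  also have "\<dots> = measure_pmf.expectation (history_law G episodic s (n * M)) (\<lambda>h. P x $ snd h)"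
  proof (rule expectation_cong)
    fix h assume "h \<in> set_pmf (history_law G episodic s (n * M))"
    then have "history_law G (continuation episodic h) (snd h) M = history_law G markov (snd h) M"
      by (intro history_law_cong continuation_episodic_profile stage_history_law)
    then show "measure_pmf.expectation (history_law G (continuation episodic h) (snd h) M)
        (\<lambda>h. x $ snd h) = P x $ snd h"
      by (simp add: P_def)
  qed
  also have "\<dots> = (P ^^ n) (P x) $ s" by (rule Suc.IH[symmetric])
  finally show ?case by (simp add: funpow_swap1 add.commute)
qed simp

text \<open>Without discounting, block \<open>n\<close> contributes the expectation of the
  finite-horizon utility \<open>v\<close> at its starting state, that is \<open>(P ^^ n) v\<close>,
  so the averages are ergodic averages.\<close>

lemma convergent_average_episodic_profile:
  assumes "\<gamma> i = 1"
  shows "convergent (\<lambda>q. expected_return G \<gamma> (q * M) episodic i s / real q)"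
proof -
  define P where "P x = (\<chi> s. measure_pmf.expectation (history_law G markov s M) (\<lambda>h. x $ snd h))"
    for x :: "real ^ 's"
  define v :: "real ^ 's" where "v = (\<chi> x. fin_utility G \<gamma> M markov i x)"
  have P: "(P ^^ n) x $ s =
      measure_pmf.expectation (history_law G episodic s (n * M)) (\<lambda>h. x $ snd h)" for n x s
    using expectation_block_state[of n x s] by (simp add: P_def[abs_def])
  have int: "integrable (history_law G markov s M) f" for s and f :: "('s, 'i, 'a) history \<Rightarrow> real"
    by (intro integrable_measure_pmf_finite finite_history_law[OF G markov_profile_fin_strategies])
  have lin: "linear P"
    by (rule linearI) (simp_all add: P_def vec_eq_iff Bochner_Integration.integral_add[OF int int])
  \<comment> \<open>Each coordinate is an expectation of coordinates of \<open>x\<close>, hence at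
    most \<open>norm x\<close> in absolute value; summing the coordinates gives the factor
    \<open>CARD('s)\<close>.\<close>
  have "norm ((P ^^ n) x) \<le> real CARD('s) * norm x" for n x
  proof -
    have "\<bar>(P ^^ n) x $ t\<bar> \<le> norm x" for t
      unfolding P
      by (intro expectation_abs_le finite_history_law[OF G episodic_profile_fin_strategies]
          component_le_norm_cart)
    then have "(\<Sum>t\<in>UNIV. \<bar>(P ^^ n) x $ t\<bar>) \<le> (\<Sum>t\<in>(UNIV :: 's set). norm x)"
      by (intro sum_mono)
    then show ?thesis using norm_le_l1_cart[of "(P ^^ n) x"] by simp
  qed
  then have "convergent (\<lambda>q. (1 / real q) *\<^sub>R (\<Sum>n<q. (P ^^ n) v))"
    by (rule mean_ergodic[OF lin])
  then have "convergent (\<lambda>q. ((1 / real q) *\<^sub>R (\<Sum>n<q. (P ^^ n) v)) $ s)"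
    unfolding convergent_def using tendsto_vec_nth by blast
  moreover have "expected_return G \<gamma> (q * M) episodic i s = (\<Sum>n<q. (P ^^ n) v $ s)" for q
  proof (induction q)
    case (Suc q)
    then show ?case
      using expected_return_episodic_profile_block[of \<gamma> q i s] assms
        by (simp add: P v_def add.commute)
  qed (simp add: expected_return_def)
  ultimately show ?thesis by (simp add: sum_component)
qed

section \<open>Passage to the infinite horizon\<close>

text \<open>For \<open>\<gamma> i = 1\<close> the increments are bounded and the block averages
  converge. For \<open>\<gamma> i < 1\<close> the returns and the normalizing sums converge
  separately, the latter to a nonzero limit.\<close>

lemma utility_exists_episodic_profile:
  assumes "0 < \<gamma> i" "\<gamma> i \<le> 1"
  shows "utility_exists G \<gamma> episodic i s"
proof -
  let ?a = "\<lambda>n. expected_return G \<gamma> n episodic i s"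
  obtain B where B: "\<And>n. \<bar>?a (Suc n) - ?a n\<bar> \<le> B * \<gamma> i ^ n"
    using expected_return_increment[OF G, of \<gamma> i] assms episodic_profile_strategies
    by (metis less_imp_le)
  show ?thesis
  proof (cases "\<gamma> i = 1")
    case True
    have "convergent (\<lambda>n. ?a n / real n)"
      by (rule convergent_average_of_blocks[OF M _ convergent_average_episodic_profile[of \<gamma> i s]])
        (use B True in auto)
    \<comment> \<open>\<open>normalized_return\<close> at \<open>K\<close> covers
      \<open>K + 1\<close> stages.\<close>
    then have "convergent (\<lambda>n. ?a (Suc n) / real (Suc n))"
      by (subst convergent_Suc_iff)
    then show ?thesis
      using True by (simp add: utility_exists_def normalized_return_def[abs_def])
  next
    case False
    then have lt: "0 \<le> \<gamma> i" "\<gamma> i < 1" using assms by auto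
    have "convergent ?a" by (rule convergent_of_geometric_increments[OF lt B])
    then obtain L where L: "?a \<longlonglongrightarrow> L" by (auto simp: convergent_def)
    have "(\<lambda>K. \<Sum>k\<le>K. \<gamma> i ^ k) \<longlonglongrightarrow> 1 / (1 - \<gamma> i)"
      using geometric_sums[of "\<gamma> i"] lt by (simp add: sums_def_le)
    then have "(\<lambda>K. 1 / (\<Sum>k\<le>K. \<gamma> i ^ k) * ?a (Suc K)) \<longlonglongrightarrow> 1 / (1 / (1 - \<gamma> i)) * L"
      using lt by (intro tendsto_intros LIMSEQ_Suc L) auto
    then show ?thesis
      by (auto simp: utility_exists_def normalized_return_def[abs_def] convergent_def)
  qed
qed

text \<open>Both limits exist, so they may be compared along block ends, where
  \<open>deviation_gain\<close> applies. Dividing by the sum of powers, not by its closed form,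
  treats the discounted and the averaged case together.\<close>

lemma utility_deviation_le:
  assumes \<sigma>: "\<sigma> \<in> strategies G i" and \<gamma>: "0 < \<gamma> i" "\<gamma> i \<le> 1"
    and opt: "\<And>x \<pi>hat. \<pi>hat \<in> fin_strategies G M i \<Longrightarrow>
      fin_utility G \<gamma> M (markov(i := \<pi>hat)) i x \<le> fin_utility G \<gamma> M markov i x + e"
    and ex: "utility_exists G \<gamma> (episodic(i := \<sigma>)) i s"
  shows "utility G \<gamma> (episodic(i := \<sigma>)) i s - utility G \<gamma> episodic i s
    \<le> (\<gamma> i ^ M * fin_utility_spread G \<gamma> M markov i + e) / (\<Sum>k<M. \<gamma> i ^ k)"
proof -
  let ?a = "\<lambda>n. expected_return G \<gamma> n episodic i s"
  let ?b = "\<lambda>n. expected_return G \<gamma> n (episodic(i := \<sigma>)) i s"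
  let ?d = "fin_utility_spread G \<gamma> M markov i"
  let ?T = "\<Sum>k<M. \<gamma> i ^ k"
  let ?S = "\<lambda>N. \<Sum>n<N. (\<gamma> i ^ M) ^ n"
  have T: "?T > 0" using \<gamma> M by (intro sum_pos) auto
  have lims: "normalized_return G \<gamma> (episodic(i := \<sigma>)) i s \<longlonglongrightarrow> utility G \<gamma> (episodic(i := \<sigma>)) i s"
    "normalized_return G \<gamma> episodic i s \<longlonglongrightarrow> utility G \<gamma> episodic i s"
    using ex utility_exists_episodic_profile[of \<gamma> i s, OF \<gamma>]
    by (simp_all add: utility_def utility_exists_def convergent_LIMSEQ_iff)
  \<comment> \<open>With this index the return covers exactly \<open>Suc N * M\<close> stages, a
    whole and positive number of blocks.\<close>
  have sub: "strict_mono (\<lambda>N. Suc N * M - 1)"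
    using M by (intro strict_monoI_Suc) simp
  have "normalized_return G \<gamma> (episodic(i := \<sigma>)) i s (Suc N * M - 1)
      - normalized_return G \<gamma> episodic i s (Suc N * M - 1) \<le> (\<gamma> i ^ M * ?d + e) / ?T" for N
  proof -
    have Suc: "Suc (Suc N * M - 1) = Suc N * M" using M by simp
    have den: "(\<Sum>k\<le>Suc N * M - 1. \<gamma> i ^ k) = ?S (Suc N) * ?T"
      unfolding lessThan_Suc_atMost[symmetric] Suc by (rule power_sum_blocks)
    have S: "?S (Suc N) > 0" using \<gamma> by (intro sum_pos) auto
    \<comment> \<open>Source of the factor \<open>\<gamma> i ^ M\<close> in front of the spread:
      omitting block \<open>0\<close> leaves the weight \<open>?S (Suc N) - 1\<close>, which is at
      most \<open>\<gamma> i ^ M * ?S (Suc N)\<close>. Nothing is divided by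
      \<open>1 - \<gamma> i ^ M\<close>, so \<open>\<gamma> i = 1\<close> is included.\<close>
    have "(1 - \<gamma> i ^ M) * ?S (Suc N) = 1 - (\<gamma> i ^ M) ^ Suc N"
      by (rule sum_gp_basic[of _ N, folded lessThan_Suc_atMost])
    also have "\<dots> \<le> 1" using \<gamma> by simp
    finally have S1: "?S (Suc N) - 1 \<le> \<gamma> i ^ M * ?S (Suc N)" by (simp only: left_diff_distrib)
    have "?b (Suc N * M) - ?a (Suc N * M)
      \<le> (\<Sum>n<Suc N. \<gamma> i ^ (n * M) * (e + (if n = 0 then 0 else ?d)))"
      by (rule deviation_gain[OF \<sigma> less_imp_le[OF \<gamma>(1)] opt])
    also have "\<dots> = e * ?S (Suc N) + ?d * (?S (Suc N) - 1)"
      by (simp add: sum.lessThan_Suc_shift sum_distrib_left sum.distrib algebra_simps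
          flip: power_mult del: sum.lessThan_Suc)
    also have "\<dots> \<le> e * ?S (Suc N) + ?d * (\<gamma> i ^ M * ?S (Suc N))"
      using S1 fin_utility_spread_nonneg by (intro add_left_mono mult_left_mono)
    also have "\<dots> = (\<gamma> i ^ M * ?d + e) * ?S (Suc N)" by (simp only: algebra_simps)
    finally have "(?b (Suc N * M) - ?a (Suc N * M)) / (?S (Suc N) * ?T)
        \<le> (\<gamma> i ^ M * ?d + e) * ?S (Suc N) / (?S (Suc N) * ?T)"
      using S T by (intro divide_right_mono) auto
    also have "\<dots> = (\<gamma> i ^ M * ?d + e) / ?T" using S by simp
    finally show ?thesis
      by (simp only: normalized_return_def Suc den diff_divide_distrib times_divide_eq_left mult_1)
  qed
  then show ?thesis
    by (intro LIMSEQ_le_const2[OF tendsto_diff[OF lims[THEN LIMSEQ_subseq_LIMSEQ, OF sub]]])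
      (auto simp: o_def)
qed

end

theorem theorem1:
  fixes G :: "('s::finite, 'i::finite, 'a) game"
    and \<gamma> \<epsilon>hat \<delta> \<epsilon> :: "'i \<Rightarrow> real"
    and M :: nat
    and \<pi>bar :: "'i \<Rightarrow> 's \<Rightarrow> nat \<Rightarrow> 'a pmf"
    and s :: 's
  assumes "stochastic_game G"
    and "\<And>i. 0 < \<gamma> i \<and> \<gamma> i \<le> 1"
    and "M \<ge> 1"
    and "\<And>i. \<pi>bar i \<in> episodic_strategies G M i"
    and "\<And>i. \<epsilon>hat i \<ge> 0"
    and "\<And>i x \<pi>hat. \<pi>hat \<in> fin_strategies G M i \<Longrightarrow>
           fin_utility G \<gamma> M (\<lambda>j. play_markov (\<pi>bar j)) i x
             \<ge> fin_utility G \<gamma> M ((\<lambda>j. play_markov (\<pi>bar j))(i := \<pi>hat)) i x - \<epsilon>hat i"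
  defines "\<delta> \<equiv> \<lambda>i. fin_utility_spread G \<gamma> M (\<lambda>j. play_markov (\<pi>bar j)) i"
  defines "\<epsilon> \<equiv> \<lambda>i. if \<gamma> i = 1 then (\<delta> i + \<epsilon>hat i) * (1 / real M)
                   else (\<gamma> i ^ M * \<delta> i + \<epsilon>hat i) * ((1 - \<gamma> i) / (1 - \<gamma> i ^ M))"
  shows "eps_episodic_equilibrium G \<gamma> M s \<epsilon> (\<lambda>i. play_episodic M (\<pi>bar i))"
proof -
  let ?\<pi> = "\<lambda>i. play_episodic M (\<pi>bar i)"
  have M: "M > 0" using assms(3) by simp
  note ctx = assms(1) M assms(4)
  \<comment> \<open>The two cases of \<open>\<epsilon>\<close> are one quotient: the sum is
    \<open>M\<close> for \<open>\<gamma> i = 1\<close> and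
    \<open>(1 - \<gamma> i ^ M) / (1 - \<gamma> i)\<close> otherwise.\<close>
  have \<epsilon>: "\<epsilon> i = (\<gamma> i ^ M * \<delta> i + \<epsilon>hat i) / (\<Sum>k<M. \<gamma> i ^ k)" for i
    by (simp add: \<epsilon>_def sum_gp_strict)
  have "utility G \<gamma> ?\<pi> i s \<ge> utility G \<gamma> (?\<pi>(i := \<sigma>)) i s - \<epsilon> i"
    if "\<sigma> \<in> strategies G i" "utility_exists G \<gamma> (?\<pi>(i := \<sigma>)) i s" for i \<sigma>
  proof -
    have "fin_utility G \<gamma> M ((\<lambda>j. play_markov (\<pi>bar j))(i := \<pi>hat)) i x
        \<le> fin_utility G \<gamma> M (\<lambda>j. play_markov (\<pi>bar j)) i x + \<epsilon>hat i"
      if "\<pi>hat \<in> fin_strategies G M i" for x \<pi>hat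
      using assms(6)[OF that, of x] by simp
    from utility_deviation_le[OF ctx that(1) _ _ this that(2)]
    show ?thesis using assms(2)[of i] by (simp add: \<epsilon> \<delta>_def)
  qed
  moreover have "utility_exists G \<gamma> ?\<pi> i s" for i
    using utility_exists_episodic_profile[OF ctx] assms(2)[of i] by blast
  ultimately show ?thesis
    using episodic_profile_strategies[OF ctx] assms(4)
    by (auto simp: eps_episodic_equilibrium_def eps_nash_equilibrium_def)
qed

end
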